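(* Let $k=\mathbb{F}_2$, $K=\mathbb{F}_2((t))$ the field of formal Laurent series over $\mathbb{F}_2$, $W=\mathbb{F}_2t$, and let $Q=Q_{k<K}(W)$ be the loop on $W\times K=\mathbb{F}_2t\times\mathbb{F}_2((t))$ with multiplication $(a,u)(b,v)=(a+b,\;u(1+b)+v(1-a))$. Let $L=\langle (t,0),(0,1)\rangle$ be the subloop of $Q$ generated by $(t,0)$ and $(0,1)$. Then $L=\{(it,\,f(1+t)^i): f\in U,\ i\in\{0,1\}\}$, where $U\subseteq K$ is the localization of $\mathbb{F}_2[t^2]$ with respect to $\{1+t^2\}$. Moreover, $L$ is an infinite nonassociative $2$-generated abelian-by-cyclic commutative automorphic loop of exponent $2$.
   Context: A loop is a set with a binary operation having a two-sided identity element and such that all translations $L_x:y\mapsto xy$ and $R_x:y\mapsto yx$ are bijections; a subloop is a subset closed under multiplication and under left and right division, and the subloop generated by a set is the smallest subloop containing it. A loop is automorphic if every element of the group generated by all $L_x,R_x$ that fixes the identity element is an automorphism of the loop. The localization of $\mathbb{F}_2[t^2]$ with respect to $\{1+t^2\}$ is the subring of $K$ generated by $\mathbb{F}_2[t^2]$ and $(1+t^2)^{-1}$. A loop is abelian-by-cyclic if it has a normal subloop (kernel of a loop homomorphism) that is an abelian group with the quotient a cyclic group. A loop has exponent $2$ if it is nontrivial and $xx$ is the identity for every element $x$. *)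

theory Defs
  imports
    "HOL-Library.Z2"
    "HOL-Computational_Algebra.Formal_Laurent_Series"
    "HOL-Algebra.Bij"
    "HOL-Algebra.Elementary_Groups"
    "HOL-Algebra.Generated_Rings"
    "HOL-Algebra.Algebraic_Closure_Type"
begin

text \<open>
  Loops are carried by the record type of HOL-Algebra monoids, so that \<open>hom\<close>, \<open>kernel\<close>,
  \<open>auto\<close> and \<open>Mod\<close> are available; their definitions do not use associativity.
\<close>

locale loop =
  fixes Q :: "('a, 'b) monoid_scheme" (structure)
  assumes m_closed: "\<lbrakk>x \<in> carrier Q; y \<in> carrier Q\<rbrakk> \<Longrightarrow> x \<otimes> y \<in> carrier Q"
    and one_closed: "\<one> \<in> carrier Q"
    and l_one: "x \<in> carrier Q \<Longrightarrow> \<one> \<otimes> x = x"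
    and r_one: "x \<in> carrier Q \<Longrightarrow> x \<otimes> \<one> = x"
    and bij_left: "x \<in> carrier Q \<Longrightarrow> bij_betw (\<lambda>y. x \<otimes> y) (carrier Q) (carrier Q)"
    and bij_right: "x \<in> carrier Q \<Longrightarrow> bij_betw (\<lambda>y. y \<otimes> x) (carrier Q) (carrier Q)"

text \<open>Restricting to the carrier makes the translations elements of \<open>BijGroup (carrier Q)\<close>.\<close>

definition left_translation :: "('a, 'b) monoid_scheme \<Rightarrow> 'a \<Rightarrow> 'a \<Rightarrow> 'a"
  where "left_translation Q x = (\<lambda>y\<in>carrier Q. x \<otimes>\<^bsub>Q\<^esub> y)"

definition right_translation :: "('a, 'b) monoid_scheme \<Rightarrow> 'a \<Rightarrow> 'a \<Rightarrow> 'a"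
  where "right_translation Q x = (\<lambda>y\<in>carrier Q. y \<otimes>\<^bsub>Q\<^esub> x)"

text \<open>\<open>x \ y\<close> is the solution \<open>z\<close> of \<open>x z = y\<close>, and \<open>y / x\<close> the solution \<open>z\<close> of \<open>z x = y\<close>.\<close>

definition left_div :: "('a, 'b) monoid_scheme \<Rightarrow> 'a \<Rightarrow> 'a \<Rightarrow> 'a"
  where "left_div Q x y = (THE z. z \<in> carrier Q \<and> x \<otimes>\<^bsub>Q\<^esub> z = y)"

definition right_div :: "('a, 'b) monoid_scheme \<Rightarrow> 'a \<Rightarrow> 'a \<Rightarrow> 'a"
  where "right_div Q y x = (THE z. z \<in> carrier Q \<and> z \<otimes>\<^bsub>Q\<^esub> x = y)"

definition subloop :: "'a set \<Rightarrow> ('a, 'b) monoid_scheme \<Rightarrow> bool"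
  where "subloop H Q \<longleftrightarrow> H \<noteq> {} \<and> H \<subseteq> carrier Q \<and>
    (\<forall>x\<in>H. \<forall>y\<in>H. x \<otimes>\<^bsub>Q\<^esub> y \<in> H \<and> left_div Q x y \<in> H \<and> right_div Q x y \<in> H)"

definition subloop_generated :: "('a, 'b) monoid_scheme \<Rightarrow> 'a set \<Rightarrow> 'a set"
  where "subloop_generated Q S = \<Inter>{H. subloop H Q \<and> S \<subseteq> H}"

definition two_generated :: "('a, 'b) monoid_scheme \<Rightarrow> bool"
  where "two_generated Q \<longleftrightarrow> loop Q \<and>
    (\<exists>x\<in>carrier Q. \<exists>y\<in>carrier Q. subloop_generated Q {x, y} = carrier Q)"

definition associative_loop :: "('a, 'b) monoid_scheme \<Rightarrow> bool"
  where "associative_loop Q \<longleftrightarrow>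
    (\<forall>x\<in>carrier Q. \<forall>y\<in>carrier Q. \<forall>z\<in>carrier Q.
      (x \<otimes>\<^bsub>Q\<^esub> y) \<otimes>\<^bsub>Q\<^esub> z = x \<otimes>\<^bsub>Q\<^esub> (y \<otimes>\<^bsub>Q\<^esub> z))"

definition commutative_loop :: "('a, 'b) monoid_scheme \<Rightarrow> bool"
  where "commutative_loop Q \<longleftrightarrow> loop Q \<and>
    (\<forall>x\<in>carrier Q. \<forall>y\<in>carrier Q. x \<otimes>\<^bsub>Q\<^esub> y = y \<otimes>\<^bsub>Q\<^esub> x)"

definition exponent_two :: "('a, 'b) monoid_scheme \<Rightarrow> bool"
  where "exponent_two Q \<longleftrightarrow> loop Q \<and> carrier Q \<noteq> {\<one>\<^bsub>Q\<^esub>} \<and> (\<forall>x\<in>carrier Q. x \<otimes>\<^bsub>Q\<^esub> x = \<one>\<^bsub>Q\<^esub>)"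

definition mult_group :: "('a, 'b) monoid_scheme \<Rightarrow> ('a \<Rightarrow> 'a) set"
  where "mult_group Q = generate (BijGroup (carrier Q))
    (left_translation Q ` carrier Q \<union> right_translation Q ` carrier Q)"

definition automorphic_loop :: "('a, 'b) monoid_scheme \<Rightarrow> bool"
  where "automorphic_loop Q \<longleftrightarrow> loop Q \<and>
    (\<forall>\<phi>\<in>mult_group Q. \<phi> \<one>\<^bsub>Q\<^esub> = \<one>\<^bsub>Q\<^esub> \<longrightarrow> \<phi> \<in> auto Q)"

text \<open>
  Ranging only over target loops \<open>M\<close> with elements of type \<open>'a set\<close> loses nothing: the image of
  a homomorphism of loops is isomorphic to the loop of its fibres, which are sets of elements of
  the domain, and restricting the target to the image does not change the kernel.
\<close>

definition normal_subloop :: "'a set \<Rightarrow> ('a, 'b) monoid_scheme \<Rightarrow> bool"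
  where "normal_subloop N Q \<longleftrightarrow>
    (\<exists>(M :: 'a set monoid) f. loop M \<and> f \<in> hom Q M \<and> N = kernel Q M f)"

text \<open>
  For a normal subloop \<open>N\<close>, the cosets \<open>N x\<close> are the fibres of a homomorphism with kernel \<open>N\<close>,
  so \<open>Q Mod N\<close> (cosets with elementwise multiplication) is the quotient loop.
\<close>

definition abelian_by_cyclic :: "('a, 'b) monoid_scheme \<Rightarrow> bool"
  where "abelian_by_cyclic Q \<longleftrightarrow> loop Q \<and>
    (\<exists>N. normal_subloop N Q \<and> comm_group (Q\<lparr>carrier := N\<rparr>) \<and>
      group (Q Mod N) \<and> cyclic_group (Q Mod N))"

text \<open>The loop \<open>Q\<^bsub>k<K\<^esub>(W)\<close>; its operations depend on \<open>K\<close> and \<open>W\<close> only.\<close>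

definition Q_loop :: "'K::field set \<Rightarrow> ('K \<times> 'K) monoid"
  where "Q_loop W = \<lparr>
    carrier = W \<times> UNIV,
    monoid.mult = (\<lambda>(a, u) (b, v). (a + b, u * (1 + b) + v * (1 - a))),
    monoid.one = (0, 0)\<rparr>"

text \<open>\<open>F\<^sub>2[t\<^sup>2]\<close> as a subset of \<open>F\<^sub>2((t))\<close>, where \<open>t\<close> is \<open>fls_X\<close>.\<close>

definition polys_in_t_squared :: "bit fls set"
  where "polys_in_t_squared = range (\<lambda>p :: bit poly. poly (map_poly fls_const p) (fls_X ^ 2))"

definition localization_t_squared :: "bit fls set"
  where "localization_t_squared =
    generate_ring ring_of_type_algebra (polys_in_t_squared \<union> {inverse (1 + fls_X ^ 2)})"

end

theory Submission
  imports Defs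
begin

text \<open>
  Since \<open>K\<close> has characteristic 2 and \<open>W = {0, t}\<close>, the loop \<open>Q\<close> consists of two copies of \<open>K\<close>.
  After rescaling the upper copy by \<open>1 + t\<close>, so that \<open>(t, f (1 + t))\<close> has coordinate \<open>f\<close>, every
  product of elements with coordinates \<open>f\<close> and \<open>g\<close> has coordinate \<open>f + g\<close>, except that two elements
  of the upper copy give \<open>(0, c (f + g))\<close> with \<open>c = (1 + t)\<^sup>2 = 1 + t\<^sup>2\<close> (\<open>QX_mult_layers\<close>).
  Everything can be read off from this table. Commutativity and exponent 2 are immediate, and
  associativity fails because \<open>c \<noteq> 1\<close>.

  Solving equations in the table needs division by \<open>c\<close> only, so the elements with coordinate in a
  ring containing \<open>c\<close> and its inverse form a subloop; this gives \<open>subloop_two_layers\<close>. Conversely,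
  let a subloop contain \<open>(t, 0)\<close> and \<open>(0, 1)\<close>. The \<open>v\<close> for which it contains \<open>(0, v)\<close> are closed
  under addition, multiplication by \<open>c\<close> (multiply twice by \<open>(t, 0)\<close>) and division by \<open>c\<close> (divide
  twice by \<open>(t, 0)\<close>). As the scalars preserving this set form a ring, it contains all of \<open>U\<close>
  (\<open>localization_subset\<close>), and multiplying once more by \<open>(t, 0)\<close> gives the upper copy.

  The first coordinate is a homomorphism onto the group \<open>{0, t}\<close> of order 2 whose kernel is the
  additive group \<open>U\<close>, so the loop is abelian-by-cyclic. It is automorphic because every
  translation is affine on each copy of \<open>K\<close> with the same linear part on both copies; this persists
  in the multiplication group (\<open>mult_group_Q_loop_affine\<close>). A map of this kind fixing the identity
  has the form \<open>(a, u) \<mapsto> (a, r u + h a)\<close> with \<open>h 0 = 0\<close>, and on \<open>{0, t}\<close> every such \<open>h\<close> satisfies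
  the identity \<open>h (a + b) = h a (1 + b) + h b (1 + a)\<close> that makes the map a homomorphism.
\<close>

section \<open>Subloops\<close>

lemma (in loop) left_div_eqI:
  assumes "x \<in> carrier Q" "z \<in> carrier Q" "x \<otimes> z = y"
  shows "left_div Q x y = z"
  unfolding left_div_def
proof (rule the_equality)
  show "z \<in> carrier Q \<and> x \<otimes> z = y" using assms by simp
next
  fix w assume w: "w \<in> carrier Q \<and> x \<otimes> w = y"
  have "inj_on (\<lambda>y. x \<otimes> y) (carrier Q)"
    using bij_left[OF assms(1)] by (simp add: bij_betw_def)
  then show "w = z" using w assms by (auto dest: inj_onD)
qed

lemma (in loop) right_div_eqI:
  assumes "x \<in> carrier Q" "z \<in> carrier Q" "z \<otimes> x = y"
  shows "right_div Q y x = z"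
  unfolding right_div_def
proof (rule the_equality)
  show "z \<in> carrier Q \<and> z \<otimes> x = y" using assms by simp
next
  fix w assume w: "w \<in> carrier Q \<and> w \<otimes> x = y"
  have "inj_on (\<lambda>y. y \<otimes> x) (carrier Q)"
    using bij_right[OF assms(1)] by (simp add: bij_betw_def)
  then show "w = z" using w assms by (auto dest: inj_onD)
qed

lemma (in loop) left_div_closed_mult:
  assumes "x \<in> carrier Q" "y \<in> carrier Q"
  shows "left_div Q x y \<in> carrier Q \<and> x \<otimes> left_div Q x y = y"
proof -
  have "y \<in> (\<lambda>y. x \<otimes> y) ` carrier Q"
    using bij_left[OF assms(1)] assms(2) by (simp add: bij_betw_def)
  then obtain z where "z \<in> carrier Q" "x \<otimes> z = y" by auto
  then show ?thesis using left_div_eqI[OF assms(1)] by simp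
qed

lemma (in loop) right_div_closed_mult:
  assumes "x \<in> carrier Q" "y \<in> carrier Q"
  shows "right_div Q y x \<in> carrier Q \<and> right_div Q y x \<otimes> x = y"
proof -
  have "y \<in> (\<lambda>y. y \<otimes> x) ` carrier Q"
    using bij_right[OF assms(1)] assms(2) by (simp add: bij_betw_def)
  then obtain z where "z \<in> carrier Q" "z \<otimes> x = y" by auto
  then show ?thesis using right_div_eqI[OF assms(1)] by simp
qed

text \<open>
  Solvability of equations inside \<open>H\<close> is easier to check than closure under the two divisions, which
  are definite descriptions over the whole carrier.
\<close>

lemma (in loop) subloopI:
  assumes "H \<noteq> {}" and HQ: "H \<subseteq> carrier Q"
    and "\<And>x y. \<lbrakk>x \<in> H; y \<in> H\<rbrakk> \<Longrightarrow> x \<otimes> y \<in> H"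
    and L: "\<And>x y. \<lbrakk>x \<in> H; y \<in> H\<rbrakk> \<Longrightarrow> \<exists>z\<in>H. x \<otimes> z = y"
    and R: "\<And>x y. \<lbrakk>x \<in> H; y \<in> H\<rbrakk> \<Longrightarrow> \<exists>z\<in>H. z \<otimes> x = y"
  shows "subloop H Q"
proof -
  have "left_div Q x y \<in> H" if xy: "x \<in> H" "y \<in> H" for x y
  proof -
    obtain z where z: "z \<in> H" "x \<otimes> z = y" using L[OF xy] by blast
    then have "left_div Q x y = z" using xy HQ by (intro left_div_eqI) auto
    then show ?thesis using z by simp
  qed
  moreover have "right_div Q x y \<in> H" if xy: "x \<in> H" "y \<in> H" for x y
  proof -
    obtain z where z: "z \<in> H" "z \<otimes> y = x" using R[OF xy(2,1)] by blast
    then have "right_div Q x y = z" using xy HQ by (intro right_div_eqI) auto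
    then show ?thesis using z by simp
  qed
  ultimately show ?thesis using assms by (simp add: subloop_def)
qed

lemma (in loop) subloop_one_closed:
  assumes "subloop H Q"
  shows "\<one> \<in> H"
proof -
  obtain x where x: "x \<in> H" using assms by (auto simp: subloop_def)
  then have "left_div Q x x = \<one>"
    using assms by (intro left_div_eqI) (auto simp: subloop_def one_closed r_one)
  then show ?thesis using assms x by (metis subloop_def)
qed

lemma (in loop) loop_subloop:
  assumes "subloop H Q"
  shows "loop (Q\<lparr>carrier := H\<rparr>)"
proof -
  have HQ: "H \<subseteq> carrier Q" and m: "\<And>x y. \<lbrakk>x \<in> H; y \<in> H\<rbrakk> \<Longrightarrow> x \<otimes> y \<in> H"
    and ld: "\<And>x y. \<lbrakk>x \<in> H; y \<in> H\<rbrakk> \<Longrightarrow> left_div Q x y \<in> H"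
    and rd: "\<And>x y. \<lbrakk>x \<in> H; y \<in> H\<rbrakk> \<Longrightarrow> right_div Q x y \<in> H"
    using assms by (auto simp: subloop_def)
  have bl: "bij_betw (\<lambda>y. x \<otimes> y) H H" if x: "x \<in> H" for x
  proof -
    have "inj_on (\<lambda>y. x \<otimes> y) H"
      using bij_left[of x] x HQ by (auto simp: bij_betw_def intro: inj_on_subset)
    moreover have "y \<in> (\<lambda>y. x \<otimes> y) ` H" if "y \<in> H" for y
      using left_div_closed_mult[of x y] ld[OF x that] x that HQ by (force intro: rev_image_eqI)
    ultimately show ?thesis using m x by (auto simp: bij_betw_def)
  qed
  have br: "bij_betw (\<lambda>y. y \<otimes> x) H H" if x: "x \<in> H" for x
  proof -
    have "inj_on (\<lambda>y. y \<otimes> x) H"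
      using bij_right[of x] x HQ by (auto simp: bij_betw_def intro: inj_on_subset)
    moreover have "y \<in> (\<lambda>y. y \<otimes> x) ` H" if "y \<in> H" for y
      using right_div_closed_mult[of x y] rd[OF that x] x that HQ by (force intro: rev_image_eqI)
    ultimately show ?thesis using m x by (auto simp: bij_betw_def)
  qed
  show ?thesis
    using m bl br HQ subloop_one_closed[OF assms]
    by (unfold_locales) (auto simp: l_one r_one)
qed

text \<open>
  Division in the loop \<open>H\<close> is a description over \<open>H\<close> rather than over \<open>carrier Q\<close>; the two agree
  because the solution found in \<open>H\<close> is the only one in \<open>Q\<close>.
\<close>

lemma (in loop) subloop_of_subloop:
  assumes H: "subloop H Q" and K: "subloop K (Q\<lparr>carrier := H\<rparr>)"
  shows "subloop K Q"
proof -
  interpret H: loop "Q\<lparr>carrier := H\<rparr>" by (rule loop_subloop[OF H])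
  have KH: "K \<subseteq> H" and HQ: "H \<subseteq> carrier Q" using H K by (auto simp: subloop_def)
  show ?thesis
  proof (rule subloopI)
    show "K \<noteq> {}" "K \<subseteq> carrier Q" using K KH HQ by (auto simp: subloop_def)
  next
    fix x y assume xy: "x \<in> K" "y \<in> K"
    show "x \<otimes> y \<in> K" using K xy by (simp add: subloop_def)
    show "\<exists>z\<in>K. x \<otimes> z = y"
      using H.left_div_closed_mult[of x y] K xy KH by (auto simp: subloop_def)
    show "\<exists>z\<in>K. z \<otimes> x = y"
      using H.right_div_closed_mult[of x y] K xy KH by (auto simp: subloop_def)
  qed
qed

lemma (in loop) subloop_generated_restrict:
  assumes H: "subloop H Q" and gen: "subloop_generated Q S = H"
  shows "subloop_generated (Q\<lparr>carrier := H\<rparr>) S = H"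
proof
  let ?L = "Q\<lparr>carrier := H\<rparr>"
  interpret L: loop ?L by (rule loop_subloop[OF H])
  have S: "S \<subseteq> H" using gen by (auto simp: subloop_generated_def)
  have "left_div ?L x y \<in> H" "right_div ?L x y \<in> H" if "x \<in> H" "y \<in> H" for x y
    using L.left_div_closed_mult[of x y] L.right_div_closed_mult[of y x] that by simp_all
  then have "subloop H ?L"
    using H by (simp add: subloop_def)
  then show "subloop_generated ?L S \<subseteq> H"
    using S by (auto simp: subloop_generated_def)
  have "H \<subseteq> K" if "subloop K ?L" "S \<subseteq> K" for K
    using subloop_of_subloop[OF H that(1)] that(2) gen by (auto simp: subloop_generated_def)
  then show "H \<subseteq> subloop_generated ?L S"
    unfolding subloop_generated_def by (intro Inter_greatest) simp
qed

section \<open>Quotients of loops that are groups\<close>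

lemma (in group) group_is_loop: "loop G"
proof
  fix x assume x: "x \<in> carrier G"
  show "bij_betw (\<lambda>y. x \<otimes> y) (carrier G) (carrier G)"
    by (rule bij_betw_byWitness[where f' = "\<lambda>y. inv x \<otimes> y"])
      (use x in \<open>auto simp: m_assoc[symmetric]\<close>)
  show "bij_betw (\<lambda>y. y \<otimes> x) (carrier G) (carrier G)"
    by (rule bij_betw_byWitness[where f' = "\<lambda>y. y \<otimes> inv x"])
      (use x in \<open>auto simp: m_assoc\<close>)
qed auto

text \<open>
  The isomorphism theorem for a homomorphism from a loop onto a group. Cosets of
  the kernel and products of fibres of \<open>f\<close> lie in single fibres, and they fill these because \<open>n x = z\<close> and \<open>x y = z\<close> can be solved for \<open>n\<close> and \<open>y\<close>.
\<close>

lemma (in loop) quotient_by_kernel_iso: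
  assumes "group G" and f: "f \<in> hom Q G" and surj: "f ` carrier Q = carrier G"
  shows "(\<lambda>a. {x \<in> carrier Q. f x = a}) \<in> iso G (Q Mod kernel Q G f)" (is "?F \<in> _")
proof -
  interpret G: group G by fact
  have fc: "f x \<in> carrier G" if "x \<in> carrier Q" for x using f that by (auto simp: hom_def)
  have fm: "f (x \<otimes> y) = f x \<otimes>\<^bsub>G\<^esub> f y" if "x \<in> carrier Q" "y \<in> carrier Q" for x y
    using f that by (auto simp: hom_def)
  have coset: "kernel Q G f #> x = ?F (f x)" if x: "x \<in> carrier Q" for x
  proof (intro equalityI subsetI)
    fix z assume "z \<in> kernel Q G f #> x"
    then show "z \<in> ?F (f x)"
      using x by (auto simp: r_coset_def kernel_def fm m_closed fc)
  next
    fix z assume z: "z \<in> ?F (f x)"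
    define n where "n = right_div Q z x"
    have n: "n \<in> carrier Q" "n \<otimes> x = z"
      using right_div_closed_mult[OF x, of z] z by (auto simp: n_def)
    then have "f n \<otimes>\<^bsub>G\<^esub> f x = f x" using z fm x by auto
    then have "f n = \<one>\<^bsub>G\<^esub>" using fc n x by (simp add: G.l_cancel_one)
    then show "z \<in> kernel Q G f #> x" using n by (auto simp: r_coset_def kernel_def)
  qed
  have mult: "?F (a \<otimes>\<^bsub>G\<^esub> b) = ?F a <#> ?F b" if ab: "a \<in> carrier G" "b \<in> carrier G" for a b
  proof (intro equalityI subsetI)
    fix z assume z: "z \<in> ?F (a \<otimes>\<^bsub>G\<^esub> b)"
    have "a \<in> f ` carrier Q" using surj ab by simp
    then obtain x where x: "x \<in> carrier Q" "f x = a" by blast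
    define y where "y = left_div Q x z"
    have y: "y \<in> carrier Q" "x \<otimes> y = z"
      using left_div_closed_mult[OF x(1), of z] z by (auto simp: y_def)
    then have "a \<otimes>\<^bsub>G\<^esub> f y = a \<otimes>\<^bsub>G\<^esub> b" using z fm x by auto
    then have "f y = b" using fc y ab by simp
    then show "z \<in> ?F a <#> ?F b" using x y by (auto simp: set_mult_def)
  next
    fix z assume "z \<in> ?F a <#> ?F b"
    then show "z \<in> ?F (a \<otimes>\<^bsub>G\<^esub> b)" by (auto simp: set_mult_def fm m_closed)
  qed
  have img: "?F ` carrier G = carrier (Q Mod kernel Q G f)"
    unfolding carrier_FactGroup surj[symmetric] image_image
    by (intro image_cong refl) (simp add: coset)
  have "inj_on ?F (carrier G)"
  proof (rule inj_onI)
    fix a b assume "a \<in> carrier G" and eq: "?F a = ?F b"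
    then have "a \<in> f ` carrier Q" using surj by simp
    then obtain x where "x \<in> carrier Q" "f x = a" by blast
    then show "a = b" using eq by blast
  qed
  with img have "bij_betw ?F (carrier G) (carrier (Q Mod kernel Q G f))"
    by (simp add: bij_betw_def)
  moreover have "?F \<in> hom G (Q Mod kernel Q G f)"
    using img by (intro homI) (auto simp: mult FactGroup_def)
  ultimately show ?thesis by (simp add: iso_def)
qed

lemma (in loop) group_quotient_by_kernel:
  assumes G: "group G" and f: "f \<in> hom Q G" and surj: "f ` carrier Q = carrier G"
  shows "group (Q Mod kernel Q G f)"
proof -
  have "{x \<in> carrier Q. f x = \<one>\<^bsub>G\<^esub>} = kernel Q G f" by (auto simp: kernel_def)
  then have "group ((Q Mod kernel Q G f)\<lparr>one := kernel Q G f\<rparr>)"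
    using group.iso_imp_img_group[OF G quotient_by_kernel_iso[OF assms]] by (simp only:)
  moreover have "(Q Mod kernel Q G f)\<lparr>one := kernel Q G f\<rparr> = Q Mod kernel Q G f"
    by (simp add: FactGroup_def)
  ultimately show ?thesis by (simp only:)
qed

text \<open>
  The target \<open>G\<close> may live on any type, whereas normality asks for a target loop on sets of elements
  of \<open>Q\<close>; the quotient itself serves.
\<close>

lemma (in loop) normal_subloop_kernel:
  assumes G: "group G" and f: "f \<in> hom Q G" and surj: "f ` carrier Q = carrier G"
  shows "normal_subloop (kernel Q G f) Q"
proof -
  let ?F = "\<lambda>a. {x \<in> carrier Q. f x = a}" and ?M = "Q Mod kernel Q G f"
  have "loop ?M" by (rule group.group_is_loop[OF group_quotient_by_kernel[OF assms]])
  moreover have "?F \<circ> f \<in> hom Q ?M"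
    using f quotient_by_kernel_iso[OF assms] by (auto simp: iso_def intro: hom_compose)
  moreover have "kernel Q G f = kernel Q ?M (?F \<circ> f)"
    by (auto simp: kernel_def)
  ultimately show ?thesis unfolding normal_subloop_def by blast
qed

lemma (in loop) abelian_by_cyclicI:
  assumes G: "group G" and f: "f \<in> hom Q G" and surj: "f ` carrier Q = carrier G"
    and cyc: "cyclic_group G" and ab: "comm_group (Q\<lparr>carrier := kernel Q G f\<rparr>)"
  shows "abelian_by_cyclic Q"
proof -
  have q: "group (Q Mod kernel Q G f)" by (rule group_quotient_by_kernel[OF G f surj])
  have "G \<cong> Q Mod kernel Q G f"
    using quotient_by_kernel_iso[OF G f surj] by (auto simp: is_iso_def)
  then have "cyclic_group (Q Mod kernel Q G f)"
    using isomorphic_group_cyclicity[OF _ G q] cyc by simp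
  then show ?thesis
    using normal_subloop_kernel[OF G f surj] q ab loop_axioms
    unfolding abelian_by_cyclic_def by blast
qed

section \<open>The loops on \<open>W \<times> K\<close>\<close>

lemma Q_loop_simps [simp]:
  "carrier (Q_loop W) = W \<times> UNIV"
  "\<one>\<^bsub>Q_loop W\<^esub> = (0, 0)"
  by (simp_all add: Q_loop_def)

lemma Q_loop_mult:
  "(a, u) \<otimes>\<^bsub>Q_loop W\<^esub> (b, v) = (a + b, u * (1 + b) + v * (1 - a))"
  by (simp add: Q_loop_def)

lemma loop_Q_loop:
  fixes W :: "'K::field set"
  assumes zero: "0 \<in> W" and add: "\<And>a b. \<lbrakk>a \<in> W; b \<in> W\<rbrakk> \<Longrightarrow> a + b \<in> W"
    and neg: "\<And>a. a \<in> W \<Longrightarrow> - a \<in> W" and one: "1 \<notin> W"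
  shows "loop (Q_loop W)"
proof
  have nz: "1 + a \<noteq> 0" "1 - a \<noteq> 0" if a: "a \<in> W" for a
  proof -
    show "1 + a \<noteq> 0" using neg[OF a] one by (metis add_eq_0_iff minus_minus)
    show "1 - a \<noteq> 0" using a one by (metis eq_iff_diff_eq_0)
  qed
  have diff: "a - b \<in> W" if "a \<in> W" "b \<in> W" for a b
    using add[OF that(1) neg[OF that(2)]] by simp
  fix x assume x: "x \<in> carrier (Q_loop W)"
  obtain b v where [simp]: "x = (b, v)" and b: "b \<in> W" using x by auto
  have [simp]: "1 + b \<noteq> 0" "b \<noteq> 1" using nz[OF b] by auto
  show "bij_betw (\<lambda>y. x \<otimes>\<^bsub>Q_loop W\<^esub> y) (carrier (Q_loop W)) (carrier (Q_loop W))"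
    by (rule bij_betw_byWitness
        [where f' = "\<lambda>(a, u). (a - b, (u - v * (1 + (a - b))) / (1 - b))"])
      (clarsimp simp: Q_loop_mult add diff b)+
  show "bij_betw (\<lambda>y. y \<otimes>\<^bsub>Q_loop W\<^esub> x) (carrier (Q_loop W)) (carrier (Q_loop W))"
    by (rule bij_betw_byWitness
        [where f' = "\<lambda>(a, u). (a - b, (u - v * (1 - (a - b))) / (1 + b))"])
      (clarsimp simp: Q_loop_mult add diff b)+
qed (use zero in \<open>clarsimp simp: Q_loop_mult add\<close>)+

text \<open>
  The translations by \<open>(b, v)\<close> multiply the second coordinate by \<open>1 - b\<close> or \<open>1 + b\<close>, whatever the first
  coordinate of the argument is. Maps shifting the first coordinate by a constant \<open>e\<close> and acting on
  the second by a common nonzero factor \<open>r\<close> and an offset \<open>h a\<close> are closed under composition and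
  inversion.
\<close>

lemma mult_group_Q_loop_affine:
  fixes W :: "'K::field set"
  assumes "loop (Q_loop W)" and H: "subloop H (Q_loop W)" and "1 \<notin> W" "- 1 \<notin> W"
    and "\<phi> \<in> mult_group (Q_loop W\<lparr>carrier := H\<rparr>)"
  shows "\<phi> \<in> Bij H \<and>
    (\<exists>e r h. r \<noteq> 0 \<and> (\<forall>a u. (a, u) \<in> H \<longrightarrow> \<phi> (a, u) = (a + e, r * u + h a)))"
    (is "_ \<and> ?P \<phi>")
proof -
  let ?L = "Q_loop W\<lparr>carrier := H\<rparr>"
  interpret L: loop ?L by (rule loop.loop_subloop[OF assms(1) H])
  have HW: "H \<subseteq> W \<times> UNIV" using H by (simp add: subloop_def)
  have nz: "1 + b \<noteq> 0" "1 - b \<noteq> 0" if "(b, v) \<in> H" for b v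
    using HW that \<open>1 \<notin> W\<close> \<open>- 1 \<notin> W\<close> by (auto simp: add_eq_0_iff)
  have left: "?P (left_translation ?L (b, v))" if "(b, v) \<in> H" for b v
    by (rule exI[of _ b], rule exI[of _ "1 - b"], rule exI[of _ "\<lambda>a. v * (1 + a)"])
      (use nz[OF that] in \<open>auto simp: left_translation_def Q_loop_mult algebra_simps\<close>)
  have right: "?P (right_translation ?L (b, v))" if "(b, v) \<in> H" for b v
    by (rule exI[of _ b], rule exI[of _ "1 + b"], rule exI[of _ "\<lambda>a. v * (1 - a)"])
      (use nz[OF that] in \<open>auto simp: right_translation_def Q_loop_mult algebra_simps\<close>)
  have bij: "left_translation ?L x \<in> Bij H" "right_translation ?L x \<in> Bij H" if "x \<in> H" for x
    using L.bij_left[of x] L.bij_right[of x] that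
    by (auto simp: Bij_def left_translation_def right_translation_def)
  have inverse: "?P (inv\<^bsub>BijGroup H\<^esub> \<psi>)" if P: "?P \<psi>" and \<psi>: "\<psi> \<in> Bij H" for \<psi>
  proof -
    obtain e r h where r: "r \<noteq> 0"
      and \<psi>e: "\<And>a u. (a, u) \<in> H \<Longrightarrow> \<psi> (a, u) = (a + e, r * u + h a)" using P by auto
    have "inv_into H \<psi> (a, u) = (a - e, u / r - h (a - e) / r)" if au: "(a, u) \<in> H" for a u
    proof -
      have img: "\<psi> ` H = H" and inj: "inj_on \<psi> H"
        using \<psi> by (simp_all add: Bij_def bij_betw_def)
      have "(a, u) \<in> \<psi> ` H" using au img by simp
      then obtain x where x': "x \<in> H" "\<psi> x = (a, u)" by force
      obtain a' u' where "x = (a', u')" by (cases x)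
      with x' have x: "(a', u') \<in> H" "\<psi> (a', u') = (a, u)" by simp_all
      have "inv_into H \<psi> (a, u) = (a', u')"
        using inv_into_f_f[OF inj x(1)] x(2) by simp
      moreover have "a = a' + e" "u = r * u' + h a'" using \<psi>e[OF x(1)] x by simp_all
      ultimately show ?thesis using r by (simp add: add_divide_distrib)
    qed
    then have "\<forall>a u. (a, u) \<in> H \<longrightarrow>
        (inv\<^bsub>BijGroup H\<^esub> \<psi>) (a, u) = (a + - e, 1 / r * u + - (h (a - e) / r))"
      unfolding inv_BijGroup[OF \<psi>] by simp
    moreover have "1 / r \<noteq> 0" using r by simp
    ultimately show ?thesis by (intro exI conjI)
  qed
  have "\<phi> \<in> generate (BijGroup H) (left_translation ?L ` H \<union> right_translation ?L ` H)"
    using assms(5) by (simp add: mult_group_def)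
  then show ?thesis
  proof induction
    case one
    have "?P (\<lambda>x\<in>H. x)"
      by (rule exI[of _ 0], rule exI[of _ 1], rule exI[of _ "\<lambda>_. 0"]) simp
    moreover have "\<one>\<^bsub>BijGroup H\<^esub> = (\<lambda>x\<in>H. x)" by (simp add: BijGroup_def)
    ultimately show ?case using id_Bij by (simp only:) blast
  next
    case (incl \<psi>)
    then show ?case using left right bij by auto
  next
    case (inv \<psi>)
    then have \<psi>: "\<psi> \<in> Bij H" "?P \<psi>" using left right bij by auto
    then have "inv\<^bsub>BijGroup H\<^esub> \<psi> \<in> Bij H"
      by (simp add: inv_BijGroup restrict_inv_into_Bij)
    then show ?case using inverse \<psi> by blast
  next
    case (eng \<psi> \<chi>)
    then have B: "\<psi> \<in> Bij H" "\<chi> \<in> Bij H" by auto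
    obtain e r h where r: "r \<noteq> 0"
      and \<psi>: "\<And>a u. (a, u) \<in> H \<Longrightarrow> \<psi> (a, u) = (a + e, r * u + h a)" using eng by auto
    obtain e' r' h' where r': "r' \<noteq> 0"
      and \<chi>: "\<And>a u. (a, u) \<in> H \<Longrightarrow> \<chi> (a, u) = (a + e', r' * u + h' a)" using eng by auto
    have "\<psi> (\<chi> (a, u)) = (a + (e' + e), (r * r') * u + (r * h' a + h (a + e')))"
      if au: "(a, u) \<in> H" for a u
    proof -
      have "\<chi> (a, u) \<in> H" using Bij_imp_funcset[OF B(2)] au by auto
      then show ?thesis using \<psi> \<chi> au by (simp add: algebra_simps)
    qed
    then have "\<forall>a u. (a, u) \<in> H \<longrightarrow>
        compose H \<psi> \<chi> (a, u) = (a + (e' + e), (r * r') * u + (r * h' a + h (a + e')))"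
      by (simp add: compose_def)
    moreover have "r * r' \<noteq> 0" using r r' by simp
    ultimately have "?P (compose H \<psi> \<chi>)" by (intro exI conjI)
    then show ?case using B by (simp add: BijGroup_def compose_Bij)
  qed
qed

section \<open>The localization of \<open>F\<^sub>2[t\<^sup>2]\<close>\<close>

lemma bit_fls_add_self [simp]:
  fixes x y :: "bit fls"
  shows "x + x = 0" "x + (x + y) = y"
proof -
  have 2: "z + z = 0" for z :: "bit fls"
    by (rule fls_eqI) (metis bit_2_eq_0 fls_plus_nth fls_zero_nth mult_2 mult_zero_left)
  then show "x + x = 0" .
  show "x + (x + y) = y" by (metis 2 add.assoc add_0)
qed

lemma bit_fls_minus:
  fixes x y :: "bit fls"
  shows "- x = x" "x - y = x + y"
  by (metis bit_fls_add_self(1) add_eq_0_iff diff_conv_add_uminus)+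

lemma localization_t_squared_closed:
  shows localization_one: "1 \<in> localization_t_squared"
    and localization_add:
      "\<lbrakk>f \<in> localization_t_squared; g \<in> localization_t_squared\<rbrakk> \<Longrightarrow> f + g \<in> localization_t_squared"
    and localization_mult:
      "\<lbrakk>f \<in> localization_t_squared; g \<in> localization_t_squared\<rbrakk> \<Longrightarrow> f * g \<in> localization_t_squared"
    and localization_inverse: "inverse (1 + fls_X ^ 2) \<in> localization_t_squared"
    and localization_X_squared: "fls_X ^ 2 \<in> localization_t_squared"
proof -
  let ?R = "ring_of_type_algebra :: bit fls ring"
  let ?H = "polys_in_t_squared \<union> {inverse (1 + fls_X ^ 2)}"
  show "1 \<in> localization_t_squared"
    using generate_ring.one[of ?R ?H]
    by (simp add: localization_t_squared_def ring_of_type_algebra_def)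
  show "f + g \<in> localization_t_squared"
    if "f \<in> localization_t_squared" "g \<in> localization_t_squared" for f g
    using generate_ring.eng_add[of f ?R ?H g] that
    by (simp add: localization_t_squared_def ring_of_type_algebra_def)
  show "f * g \<in> localization_t_squared"
    if "f \<in> localization_t_squared" "g \<in> localization_t_squared" for f g
    using generate_ring.eng_mult[of f ?R ?H g] that
    by (simp add: localization_t_squared_def ring_of_type_algebra_def)
  show "inverse (1 + fls_X ^ 2) \<in> localization_t_squared"
    unfolding localization_t_squared_def by (rule generate_ring.incl) simp
  have "fls_X ^ 2 \<in> polys_in_t_squared"
    unfolding polys_in_t_squared_def
    by (rule range_eqI[of _ _ "[:0, 1:]"]) (simp add: map_poly_pCons)
  then show "fls_X ^ 2 \<in> localization_t_squared"
    unfolding localization_t_squared_def by (intro generate_ring.incl) simp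
qed

lemma localization_zero: "0 \<in> localization_t_squared"
  using localization_add[OF localization_one localization_one] by simp

lemma localization_power:
  "f \<in> localization_t_squared \<Longrightarrow> f ^ n \<in> localization_t_squared"
  by (induction n) (auto simp: localization_one localization_mult)

lemma infinite_localization: "infinite localization_t_squared"
proof -
  have "inj (\<lambda>n. (fls_X ^ 2 :: bit fls) ^ n)"
  proof (rule injI)
    fix m n assume "(fls_X ^ 2 :: bit fls) ^ m = (fls_X ^ 2) ^ n"
    then have "fls_subdegree (fls_X ^ (2 * m) :: bit fls) = fls_subdegree (fls_X ^ (2 * n) :: bit fls)"
      by (simp only: power_mult)
    then show "m = n" by (simp only: fls_subdegree_fls_X_pow)
  qed
  moreover have "range (\<lambda>n. (fls_X ^ 2 :: bit fls) ^ n) \<subseteq> localization_t_squared"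
    using localization_power[OF localization_X_squared] by auto
  ultimately show ?thesis by (meson finite_subset range_inj_infinite)
qed

text \<open>
  The hypotheses are what a subloop of \<open>Q\<close> provides; they make \<open>V\<close> a module over the localization. The
  scalars mapping \<open>V\<close> to itself form a subring, which contains the generators of the
  localization, and such a scalar is recovered by applying it to \<open>1\<close>.
\<close>

lemma localization_subset:
  assumes one: "1 \<in> V" and add: "\<And>u v. \<lbrakk>u \<in> V; v \<in> V\<rbrakk> \<Longrightarrow> u + v \<in> V"
    and unit: "\<And>v. v \<in> V \<Longrightarrow> (1 + fls_X ^ 2) * v \<in> V"
    and inv: "\<And>v. v \<in> V \<Longrightarrow> inverse (1 + fls_X ^ 2) * v \<in> V"
  shows "localization_t_squared \<subseteq> V"
proof
  let ?R = "ring_of_type_algebra :: bit fls ring"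
  have zero: "0 \<in> V" using add[OF one one] by simp
  \<comment> \<open>\<open>t\<^sup>2 = 1 + (1 + t\<^sup>2)\<close> in characteristic 2\<close>
  have X2: "fls_X ^ 2 * v \<in> V" if "v \<in> V" for v
    using add[OF that unit[OF that]] by (simp add: distrib_right)
  have poly: "poly (map_poly fls_const p) (fls_X ^ 2) * v \<in> V" if v: "v \<in> V" for p v
  proof (induction p)
    case 0
    show ?case using zero by simp
  next
    case (pCons a p)
    have "fls_const a * v \<in> V" using v zero by (cases a) auto
    then show ?case
      using add X2[OF pCons.IH] by (simp add: map_poly_pCons distrib_right mult.assoc)
  qed
  have neg: "\<ominus>\<^bsub>?R\<^esub> h = h" for h
    by (rule abelian_group.minus_equality[OF ring.is_abelian_group[OF ring_from_type_algebra]])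
      (simp_all add: ring_of_type_algebra_def)
  fix f assume "f \<in> localization_t_squared"
  then have "\<forall>v\<in>V. f * v \<in> V"
    unfolding localization_t_squared_def
  proof induction
    case one
    show ?case by (simp add: ring_of_type_algebra_def)
  next
    case (incl h)
    then show ?case using poly inv by (auto simp: polys_in_t_squared_def)
  next
    case (a_inv h)
    then show ?case by (simp add: neg)
  next
    case (eng_add h1 h2)
    then show ?case using add by (simp add: ring_of_type_algebra_def distrib_right)
  next
    case (eng_mult h1 h2)
    then show ?case by (simp add: ring_of_type_algebra_def mult.assoc)
  qed
  then show "f \<in> V" using one by force
qed

section \<open>The subloop generated by \<open>(t, 0)\<close> and \<open>(0, 1)\<close>\<close>

definition two_layers :: "(bit fls \<times> bit fls) set"
  where "two_layers =
    {(of_nat i * fls_X, f * (1 + fls_X) ^ i) | i f. f \<in> localization_t_squared \<and> i \<in> {0, 1::nat}}"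

lemma two_layers_eq:
  "two_layers = Pair 0 ` localization_t_squared \<union>
    (\<lambda>f. (fls_X, f * (1 + fls_X))) ` localization_t_squared"
proof -
  have "two_layers = (\<Union>i\<in>{0, 1::nat}.
      (\<lambda>f. (of_nat i * fls_X, f * (1 + fls_X) ^ i)) ` localization_t_squared)"
    unfolding two_layers_def by blast
  then show ?thesis by simp
qed

lemma two_layers_memI:
  assumes "f \<in> localization_t_squared"
  shows "(0, f) \<in> two_layers" "(fls_X, f * (1 + fls_X)) \<in> two_layers"
  using assms by (auto simp: two_layers_eq)

lemma span_t_eq: "{fls_const c * fls_X | c :: bit. True} = {0, fls_X}"
proof -
  have "{fls_const c * fls_X | c :: bit. True} = (\<lambda>c :: bit. fls_const c * fls_X) ` UNIV" by blast
  also have "(UNIV :: bit set) = {0, 1}" by (auto intro: bit.exhaust)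
  finally show ?thesis by simp
qed

lemma one_neq_fls_X: "1 \<noteq> (fls_X :: bit fls)" "1 + (fls_X :: bit fls) \<noteq> 0"
proof -
  have "fls_nth (1 :: bit fls) 1 \<noteq> fls_nth fls_X 1" by simp
  then show *: "1 \<noteq> (fls_X :: bit fls)" by metis
  then show "1 + (fls_X :: bit fls) \<noteq> 0" by (simp add: add_eq_0_iff bit_fls_minus)
qed

abbreviation QX :: "(bit fls \<times> bit fls) monoid"
  where "QX \<equiv> Q_loop {0, fls_X}"

lemma loop_QX: "loop QX"
  by (rule loop_Q_loop) (use one_neq_fls_X in \<open>auto simp: bit_fls_minus\<close>)

lemma one_plus_X_square: "(1 + fls_X) * (1 + fls_X) = (1 + fls_X ^ 2 :: bit fls)"
  by (simp add: algebra_simps power2_eq_square)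

lemma QX_mult: "(a, u) \<otimes>\<^bsub>QX\<^esub> (b, v) = (a + b, u * (1 + b) + v * (1 + a))"
  by (simp add: Q_loop_mult bit_fls_minus)

text \<open>
  Scaling the upper layer by \<open>1 + t\<close> absorbs the factor \<open>1 + t\<close> that a mixed product would
  otherwise apply to the summand from the lower layer.
\<close>

lemma QX_mult_layers:
  shows "(0, f) \<otimes>\<^bsub>QX\<^esub> (0, g) = (0, f + g)"
    and "(0, f) \<otimes>\<^bsub>QX\<^esub> (fls_X, g * (1 + fls_X)) = (fls_X, (f + g) * (1 + fls_X))"
    and "(fls_X, f * (1 + fls_X)) \<otimes>\<^bsub>QX\<^esub> (0, g) = (fls_X, (f + g) * (1 + fls_X))"
    and "(fls_X, f * (1 + fls_X)) \<otimes>\<^bsub>QX\<^esub> (fls_X, g * (1 + fls_X)) = (0, (1 + fls_X ^ 2) * (f + g))"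
  by (simp_all add: QX_mult flip: one_plus_X_square) (simp_all add: algebra_simps)

lemma QX_commute:
  "x \<otimes>\<^bsub>QX\<^esub> y = y \<otimes>\<^bsub>QX\<^esub> x"
  by (cases x; cases y) (simp add: QX_mult add.commute)

lemma subloop_two_layers: "subloop two_layers QX"
proof (rule loop.subloopI[OF loop_QX])
  let ?U = localization_t_squared and ?c = "1 + fls_X ^ 2 :: bit fls"
  have c: "?c \<in> ?U" by (rule localization_add[OF localization_one localization_X_squared])
  have c0: "?c \<noteq> 0" using one_neq_fls_X(2) unfolding one_plus_X_square[symmetric] by simp
  show "two_layers \<noteq> {}" using localization_one by (auto simp: two_layers_eq)
  show "two_layers \<subseteq> carrier QX" by (auto simp: two_layers_eq)
  fix x y assume "x \<in> two_layers" and "y \<in> two_layers"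
  then consider
      f g where "f \<in> ?U" "g \<in> ?U" "x = (0, f)" "y = (0, g)"
    | f g where "f \<in> ?U" "g \<in> ?U" "x = (0, f)" "y = (fls_X, g * (1 + fls_X))"
    | f g where "f \<in> ?U" "g \<in> ?U" "x = (fls_X, f * (1 + fls_X))" "y = (0, g)"
    | f g where "f \<in> ?U" "g \<in> ?U" "x = (fls_X, f * (1 + fls_X))" "y = (fls_X, g * (1 + fls_X))"
    unfolding two_layers_eq by blast
  then have "x \<otimes>\<^bsub>QX\<^esub> y \<in> two_layers \<and> (\<exists>z\<in>two_layers. x \<otimes>\<^bsub>QX\<^esub> z = y)"
  proof cases
    case 1
    then have fg: "f + g \<in> ?U" by (simp add: localization_add)
    have mult: "x \<otimes>\<^bsub>QX\<^esub> y = (0, f + g)" by (simp only: 1 QX_mult_layers)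
    have div: "x \<otimes>\<^bsub>QX\<^esub> (0, f + g) = y" unfolding 1 QX_mult_layers by simp
    show ?thesis unfolding mult using div two_layers_memI[OF fg] by blast
  next
    case 2
    then have fg: "f + g \<in> ?U" by (simp add: localization_add)
    have mult: "x \<otimes>\<^bsub>QX\<^esub> y = (fls_X, (f + g) * (1 + fls_X))" by (simp only: 2 QX_mult_layers)
    have div: "x \<otimes>\<^bsub>QX\<^esub> (fls_X, (f + g) * (1 + fls_X)) = y" unfolding 2 QX_mult_layers by simp
    show ?thesis unfolding mult using div two_layers_memI[OF fg] by blast
  next
    case 3
    \<comment> \<open>the quotient lies in the upper layer, and solving \<open>c (f + h) = g\<close> is where \<open>c\<close> must be a unit\<close>
    then have fg: "f + g \<in> ?U" "f + inverse ?c * g \<in> ?U"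
      by (simp_all add: localization_add localization_mult localization_inverse)
    have mult: "x \<otimes>\<^bsub>QX\<^esub> y = (fls_X, (f + g) * (1 + fls_X))" by (simp only: 3 QX_mult_layers)
    have div: "x \<otimes>\<^bsub>QX\<^esub> (fls_X, (f + inverse ?c * g) * (1 + fls_X)) = y"
      unfolding 3 QX_mult_layers using c0 by (simp add: mult.assoc[symmetric])
    show ?thesis unfolding mult using div two_layers_memI[OF fg(1)] two_layers_memI[OF fg(2)] by blast
  next
    case 4
    then have fg: "f + g \<in> ?U" "?c * (f + g) \<in> ?U"
      by (simp_all add: localization_add localization_mult c)
    have mult: "x \<otimes>\<^bsub>QX\<^esub> y = (0, ?c * (f + g))" by (simp only: 4 QX_mult_layers)
    have div: "x \<otimes>\<^bsub>QX\<^esub> (0, f + g) = y" unfolding 4 QX_mult_layers by simp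
    show ?thesis unfolding mult using div two_layers_memI[OF fg(1)] two_layers_memI[OF fg(2)] by blast
  qed
  then show "x \<otimes>\<^bsub>QX\<^esub> y \<in> two_layers" "\<exists>z\<in>two_layers. x \<otimes>\<^bsub>QX\<^esub> z = y"
    "\<exists>z\<in>two_layers. z \<otimes>\<^bsub>QX\<^esub> x = y"
    by (simp_all only: QX_commute[of _ x])
qed

text \<open>
  Two multiplications by \<open>(t, 0)\<close> move \<open>(0, v)\<close> to the upper layer and back, multiplying \<open>v\<close> by
  \<open>1 + t\<^sup>2\<close>; two left divisions by \<open>(t, 0)\<close> undo this.
\<close>

lemma two_layers_subset_subloop:
  assumes H: "subloop H QX" and gens: "(fls_X, 0) \<in> H" "(0, 1) \<in> H"
  shows "two_layers \<subseteq> H"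
proof -
  have mult: "x \<otimes>\<^bsub>QX\<^esub> y \<in> H" if "x \<in> H" "y \<in> H" for x y
    using H that by (simp add: subloop_def)
  have div: "z \<in> H" if "x \<in> H" "y \<in> H" "z \<in> carrier QX" "x \<otimes>\<^bsub>QX\<^esub> z = y" for x y z
  proof -
    have "left_div QX x y = z"
      using loop.left_div_eqI[OF loop_QX _ that(3,4)] H that(1) by (auto simp: subloop_def)
    then show ?thesis using H that(1,2) by (auto simp: subloop_def)
  qed
  have up: "(fls_X, v * (1 + fls_X)) \<in> H" if "(0, v) \<in> H" for v
    using mult[OF gens(1) that] QX_mult_layers(3)[of 0 v] by simp
  have "localization_t_squared \<subseteq> {v. (0, v) \<in> H}"
  proof (rule localization_subset)
    show "1 \<in> {v. (0, v) \<in> H}" using gens by simp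
  next
    fix u v assume "u \<in> {v. (0, v) \<in> H}" "v \<in> {v. (0, v) \<in> H}"
    then show "u + v \<in> {v. (0, v) \<in> H}"
      using mult[of "(0, u)" "(0, v)"] by (simp add: QX_mult_layers(1))
  next
    fix v assume "v \<in> {v. (0, v) \<in> H}"
    then have v: "(0, v) \<in> H" by simp
    show "(1 + fls_X ^ 2) * v \<in> {v. (0, v) \<in> H}"
      using mult[OF gens(1) up[OF v]] QX_mult_layers(4)[of 0 v] by simp
    let ?w = "inverse (1 + fls_X ^ 2) * v"
    have c0: "1 + fls_X ^ 2 \<noteq> (0 :: bit fls)"
      using one_neq_fls_X(2) unfolding one_plus_X_square[symmetric] by simp
    have "(fls_X, 0) \<otimes>\<^bsub>QX\<^esub> (fls_X, ?w * (1 + fls_X)) = (0, v)"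
      using QX_mult_layers(4)[of 0 ?w] c0 by (simp add: mult.assoc[symmetric])
    then have "(fls_X, ?w * (1 + fls_X)) \<in> H" by (rule div[OF gens(1) v, rotated]) simp
    moreover have "(fls_X, 0) \<otimes>\<^bsub>QX\<^esub> (0, ?w) = (fls_X, ?w * (1 + fls_X))"
      using QX_mult_layers(3)[of 0 ?w] by simp
    ultimately show "?w \<in> {v. (0, v) \<in> H}" using div[OF gens(1), of _ "(0, ?w)"] by simp
  qed
  then show ?thesis using up by (auto simp: two_layers_eq)
qed

lemma subloop_generated_two_layers: "subloop_generated QX {(fls_X, 0), (0, 1)} = two_layers"
proof
  have "(fls_X, 0 * (1 + fls_X)) \<in> two_layers" "(0, 1) \<in> two_layers"
    unfolding two_layers_eq using localization_zero localization_one by blast+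
  then show "subloop_generated QX {(fls_X, 0), (0, 1)} \<subseteq> two_layers"
    using subloop_two_layers by (auto simp: subloop_generated_def)
  show "two_layers \<subseteq> subloop_generated QX {(fls_X, 0), (0, 1)}"
    unfolding subloop_generated_def
    by (intro Inter_greatest) (simp add: two_layers_subset_subloop)
qed

abbreviation LX :: "(bit fls \<times> bit fls) monoid"
  where "LX \<equiv> QX\<lparr>carrier := two_layers\<rparr>"

lemma loop_LX: "loop LX"
  by (rule loop.loop_subloop[OF loop_QX subloop_two_layers])

text \<open>
  A map \<open>(a, u) \<mapsto> (a, r u + h a)\<close> is multiplicative exactly when
  \<open>h (a + b) = h a (1 + b) + h b (1 + a)\<close>. For \<open>a = 0\<close> or \<open>b = 0\<close> this follows from \<open>h 0 = 0\<close>, and for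
  \<open>a = b = t\<close> both sides vanish in characteristic 2.
\<close>

lemma automorphic_LX: "automorphic_loop LX"
  unfolding automorphic_loop_def
proof (intro conjI ballI impI loop_LX)
  fix \<phi> assume \<phi>: "\<phi> \<in> mult_group LX" and fix1: "\<phi> \<one>\<^bsub>LX\<^esub> = \<one>\<^bsub>LX\<^esub>"
  have "\<phi> \<in> Bij two_layers \<and> (\<exists>e r h. r \<noteq> 0 \<and>
      (\<forall>a u. (a, u) \<in> two_layers \<longrightarrow> \<phi> (a, u) = (a + e, r * u + h a)))"
    by (rule mult_group_Q_loop_affine[OF loop_QX subloop_two_layers _ _ \<phi>])
      (use one_neq_fls_X in \<open>auto simp: bit_fls_minus\<close>)
  then obtain e r h where bij: "\<phi> \<in> Bij two_layers"
    and eq: "\<And>a u. (a, u) \<in> two_layers \<Longrightarrow> \<phi> (a, u) = (a + e, r * u + h a)" by blast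
  have "(0, 0) \<in> two_layers" using localization_zero by (simp add: two_layers_eq)
  then have e: "e = 0" and h0: "h 0 = 0" using eq[of 0 0] fix1 by simp_all
  have "\<phi> \<in> hom LX LX"
  proof (rule homI)
    fix x assume "x \<in> carrier LX"
    then show "\<phi> x \<in> carrier LX" using Bij_imp_funcset[OF bij] by auto
  next
    fix x y assume "x \<in> carrier LX" "y \<in> carrier LX"
    then have xy: "x \<in> two_layers" "y \<in> two_layers" by simp_all
    obtain a u b v where [simp]: "x = (a, u)" "y = (b, v)" by (cases x, cases y)
    have "a \<in> {0, fls_X}" "b \<in> {0, fls_X}" using xy by (auto simp: two_layers_eq)
    then have h: "h (a + b) = h a * (1 + b) + h b * (1 + a)"
      using h0 by (auto simp flip: distrib_right)
    have "x \<otimes>\<^bsub>QX\<^esub> y \<in> two_layers" using subloop_two_layers xy by (simp add: subloop_def)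
    then have "\<phi> (x \<otimes>\<^bsub>QX\<^esub> y) = (a + b, r * (u * (1 + b) + v * (1 + a)) + h (a + b))"
      using eq e by (simp add: QX_mult)
    also have "\<dots> = \<phi> x \<otimes>\<^bsub>QX\<^esub> \<phi> y"
      using eq xy e by (simp add: QX_mult h algebra_simps)
    finally show "\<phi> (x \<otimes>\<^bsub>LX\<^esub> y) = \<phi> x \<otimes>\<^bsub>LX\<^esub> \<phi> y" by simp
  qed
  then show "\<phi> \<in> auto LX" using bij by (simp add: auto_def)
qed

lemma abelian_by_cyclic_LX: "abelian_by_cyclic LX"
proof -
  let ?G = "\<lparr>carrier = {0, fls_X :: bit fls}, monoid.mult = (+), one = 0\<rparr>"
  have G: "group ?G" by (rule groupI) (auto simp: add.assoc)
  interpret G: group ?G by (rule G)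
  have f: "fst \<in> hom LX ?G"
    by (rule homI) (auto simp: two_layers_eq QX_mult)
  have surj: "fst ` carrier LX = carrier ?G"
    using localization_zero by (force simp: two_layers_eq image_Un image_image)
  have cyc: "cyclic_group ?G"
  proof -
    let ?pow = "\<lambda>n::int. fls_X [^]\<^bsub>?G\<^esub> n"
    have "0 \<in> range ?pow" by (rule range_eqI[of _ _ 0]) simp
    moreover have "fls_X \<in> range ?pow"
      by (rule range_eqI[of _ _ 1]) (subst G.int_pow_1, auto)
    moreover have "?pow n \<in> {0, fls_X}" for n
      using G.int_pow_closed[of fls_X n] by simp
    ultimately have "carrier ?G = range ?pow" by auto
    then show ?thesis unfolding G.cyclic_group by (intro bexI[of _ fls_X]) auto
  qed
  have ker: "kernel LX ?G fst = Pair 0 ` localization_t_squared"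
    by (auto simp: kernel_def two_layers_eq)
  have neg: "\<exists>g\<in>localization_t_squared. f + g = 0" if "f \<in> localization_t_squared" for f
    using that by (intro bexI[of _ f]) simp_all
  have "comm_group (LX\<lparr>carrier := kernel LX ?G fst\<rparr>)"
    unfolding ker
    by (rule comm_groupI)
      (auto simp: QX_mult localization_zero localization_add neg add.commute add.assoc)
  then show ?thesis by (rule loop.abelian_by_cyclicI[OF loop_LX G f surj cyc])
qed

theorem lemma5p2:
  fixes t :: "bit fls"
    and W U :: "bit fls set"
    and Q :: "(bit fls \<times> bit fls) monoid"
    and L :: "(bit fls \<times> bit fls) set"
  assumes t: "t = fls_X"
    and W: "W = {fls_const c * t | c. True}"
    and Q: "Q = Q_loop W"
    and L: "L = subloop_generated Q {(t, 0), (0, 1)}"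
    and U: "U = localization_t_squared"
  shows "loop Q
    \<and> L = {(of_nat i * t, f * (1 + t) ^ i) | i f. f \<in> U \<and> i \<in> {0, 1::nat}}
    \<and> infinite L
    \<and> \<not> associative_loop (Q\<lparr>carrier := L\<rparr>)
    \<and> two_generated (Q\<lparr>carrier := L\<rparr>)
    \<and> abelian_by_cyclic (Q\<lparr>carrier := L\<rparr>)
    \<and> commutative_loop (Q\<lparr>carrier := L\<rparr>)
    \<and> automorphic_loop (Q\<lparr>carrier := L\<rparr>)
    \<and> exponent_two (Q\<lparr>carrier := L\<rparr>)"
proof -
  have QX: "Q = QX" using Q W t span_t_eq by simp
  have LX: "L = two_layers" using L QX t subloop_generated_two_layers by simp
  have gens: "(fls_X, 0) \<in> two_layers" "(0, 1) \<in> two_layers"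
    unfolding subloop_generated_two_layers[symmetric] by (auto simp: subloop_generated_def)
  have inf: "infinite two_layers"
    using infinite_localization finite_imageD[of "Pair (0 :: bit fls)"]
    unfolding two_layers_eq by (auto simp: inj_on_def)
  have nonassoc: "\<not> associative_loop LX"
  proof
    assume "associative_loop LX"
    then have "((fls_X, 0) \<otimes>\<^bsub>QX\<^esub> (fls_X, 0)) \<otimes>\<^bsub>QX\<^esub> (0, 1) =
        (fls_X, 0) \<otimes>\<^bsub>QX\<^esub> ((fls_X, 0) \<otimes>\<^bsub>QX\<^esub> (0, 1))"
      using gens unfolding associative_loop_def by auto
    then have "1 = (1 + fls_X) * (1 + fls_X :: bit fls)" by (simp add: QX_mult)
    then show False by (simp add: one_plus_X_square)
  qed
  have gen2: "two_generated LX"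
    unfolding two_generated_def
    using loop_LX gens loop.subloop_generated_restrict
      [OF loop_QX subloop_two_layers subloop_generated_two_layers] by auto
  have comm: "commutative_loop LX"
    unfolding commutative_loop_def using loop_LX QX_commute by simp
  have exp: "exponent_two LX"
    unfolding exponent_two_def
  proof (intro conjI loop_LX ballI)
    have "two_layers \<noteq> {(0, 0)}" using inf by (metis finite.emptyI finite_insert)
    then show "carrier LX \<noteq> {\<one>\<^bsub>LX\<^esub>}" by simp
    fix x assume "x \<in> carrier LX"
    then show "x \<otimes>\<^bsub>LX\<^esub> x = \<one>\<^bsub>LX\<^esub>" by (cases x) (simp add: QX_mult)
  qed
  show ?thesis
    using loop_QX inf nonassoc gen2 abelian_by_cyclic_LX comm automorphic_LX exp
    unfolding QX LX t U two_layers_def[symmetric] by blast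
qed

end
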